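(* Let $G$ be a compact Lie group, let $f,g\colon X\to Y$ be $G$-maps between $G$-spaces, and let $$\mathcal{P}(f,g)=\{(x,\gamma)\in X\times Y^I \mid f(x)=\gamma(0),\ g(x)=\gamma(1)\},\qquad \bar{\pi}_Y\colon \mathcal{P}(f,g)\to X,\quad \bar\pi_Y(x,\gamma)=x,$$ be the pullback of the path fibration $\pi_Y\colon Y^I\to Y\times Y$, $\pi_Y(\gamma)=(\gamma(0),\gamma(1))$, along the $G$-map $(f,g)\colon X\to Y\times Y$. Then $$D_G(f,g)=\mathrm{secat}_G(\bar{\pi}_Y).$$
   Context: $G$ is a compact Lie group; $\simeq_G$ denotes $G$-homotopy. $I=[0,1]$, $Y^I$ is the space of paths in $Y$ with the $G$-action $(g\gamma)(t)=g\gamma(t)$; products carry the diagonal action. Equivariant homotopic distance: for $G$-maps $f,g\colon X\to Y$, $D_G(f,g)$ is the least integer $n\ge 0$ such that $X$ has an open cover $\{U_0,\dots,U_n\}$ by $G$-invariant open sets with $f|_{U_i}\simeq_G g|_{U_i}$ for all $0\le i\le n$; it is $\infty$ if no such $n$ exists. Equivariant sectional category: for a $G$-map $p\colon E\to B$, $\mathrm{secat}_G(p)$ is the least integer $n\ge 0$ such that $B$ has a cover by $n+1$ $G$-invariant open subsets $U_0,\dots,U_n$ and, for each $i$, a $G$-map $s_i\colon U_i\to E$ with $p\circ s_i\simeq_G \mathrm{inc}_{U_i}$, where $\mathrm{inc}_{U_i}\colon U_i\hookrightarrow B$ is the inclusion; it is $\infty$ if no such $n$ exists. *)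

theory Defs
  imports "HOL-Analysis.Analysis" "HOL-Algebra.Group_Action" "HOL-Library.Extended_Nat"
begin

section \<open>Compact Lie groups\<close>

text \<open>
  Charts take values in \<^term>\<open>Euclidean_space n\<close>, i.e. the sequences of reals that vanish from index
  \<^term>\<open>n\<close> on, so that dimension 0 (finite groups) is included.
  For an open subset \<^term>\<open>S\<close> of \<^term>\<open>Euclidean_space n\<close>, \<open>Ck_on n k S f\<close> says that all iterated
  partial derivatives of \<^term>\<open>f\<close> of order at most \<^term>\<open>k\<close> exist and are continuous on \<^term>\<open>S\<close>.
  Since \<^term>\<open>S\<close> is open, the values of \<^term>\<open>f\<close> outside \<^term>\<open>S\<close> are irrelevant.
\<close>

primrec Ck_on :: "nat \<Rightarrow> nat \<Rightarrow> (nat \<Rightarrow> real) set \<Rightarrow> ((nat \<Rightarrow> real) \<Rightarrow> real) \<Rightarrow> bool" where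
  "Ck_on n 0 S f \<longleftrightarrow> continuous_map (subtopology (Euclidean_space n) S) euclideanreal f"
| "Ck_on n (Suc k) S f \<longleftrightarrow>
     continuous_map (subtopology (Euclidean_space n) S) euclideanreal f \<and>
     (\<forall>i<n. \<exists>f'. (\<forall>x\<in>S. ((\<lambda>t. f (x(i := t))) has_real_derivative f' x) (at (x i))) \<and> Ck_on n k S f')"

definition smooth_on ::
  "nat \<Rightarrow> nat \<Rightarrow> (nat \<Rightarrow> real) set \<Rightarrow> ((nat \<Rightarrow> real) \<Rightarrow> nat \<Rightarrow> real) \<Rightarrow> bool" where
  "smooth_on n m S F \<longleftrightarrow> (\<forall>k. \<forall>j<m. Ck_on n k S (\<lambda>x. F x j))"

text \<open>A chart is a pair of its domain and the coordinate map; the latter is only relevant on the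
  domain \<^term>\<open>U\<close>, and its inverse is \<^term>\<open>inv_into U c\<close>.\<close>

type_synonym 'a chart = "'a set \<times> ('a \<Rightarrow> nat \<Rightarrow> real)"

definition smooth_map ::
  "'a topology \<Rightarrow> nat \<Rightarrow> 'a chart set \<Rightarrow> 'b topology \<Rightarrow> nat \<Rightarrow> 'b chart set \<Rightarrow> ('a \<Rightarrow> 'b) \<Rightarrow> bool" where
  "smooth_map S n A T m B F \<longleftrightarrow>
     continuous_map S T F \<and>
     (\<forall>(U, c)\<in>A. \<forall>(V, d)\<in>B. smooth_on n m (c ` (U \<inter> F -` V)) (d \<circ> F \<circ> inv_into U c))"

definition smooth_manifold :: "'a topology \<Rightarrow> nat \<Rightarrow> 'a chart set \<Rightarrow> bool" where
  "smooth_manifold T n A \<longleftrightarrow>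
     Hausdorff_space T \<and> second_countable T \<and>
     (\<Union>(U, c)\<in>A. U) = topspace T \<and>
     (\<forall>(U, c)\<in>A. openin T U \<and> openin (Euclidean_space n) (c ` U) \<and>
        homeomorphic_map (subtopology T U) (subtopology (Euclidean_space n) (c ` U)) c) \<and>
     (\<forall>(U, c)\<in>A. \<forall>(V, d)\<in>A. smooth_on n n (c ` (U \<inter> V)) (d \<circ> inv_into U c))"

text \<open>The product charts, with \<open>\<real>\<^sup>n \<times> \<real>\<^sup>m\<close> identified with \<open>\<real>\<^sup>n\<^sup>+\<^sup>m\<close> by concatenation.\<close>

definition prod_atlas :: "nat \<Rightarrow> 'a chart set \<Rightarrow> 'b chart set \<Rightarrow> ('a \<times> 'b) chart set" where
  "prod_atlas n A B =
     {(U \<times> V, \<lambda>(x, y) i. if i < n then c x i else d y (i - n)) | U c V d. (U, c) \<in> A \<and> (V, d) \<in> B}"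

definition compact_Lie_group ::
  "('g, 'x) monoid_scheme \<Rightarrow> 'g topology \<Rightarrow> nat \<Rightarrow> 'g chart set \<Rightarrow> bool" where
  "compact_Lie_group G T n A \<longleftrightarrow>
     group G \<and> topspace T = carrier G \<and> smooth_manifold T n A \<and>
     smooth_map (prod_topology T T) (n + n) (prod_atlas n A A) T n A (\<lambda>(g, h). g \<otimes>\<^bsub>G\<^esub> h) \<and>
     smooth_map T n A T n A (\<lambda>g. inv\<^bsub>G\<^esub> g) \<and>
     compact_space T"


section \<open>G-spaces, G-maps and G-homotopies\<close>

definition G_space ::
  "('g, 'x) monoid_scheme \<Rightarrow> 'g topology \<Rightarrow> 'a topology \<Rightarrow> ('g \<Rightarrow> 'a \<Rightarrow> 'a) \<Rightarrow> bool" where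
  "G_space G T X \<phi> \<longleftrightarrow>
     group_action G (topspace X) \<phi> \<and>
     continuous_map (prod_topology T X) X (\<lambda>(g, x). \<phi> g x)"

definition equivariant_on ::
  "('g, 'x) monoid_scheme \<Rightarrow> 'a set \<Rightarrow> ('g \<Rightarrow> 'a \<Rightarrow> 'a) \<Rightarrow> ('g \<Rightarrow> 'b \<Rightarrow> 'b) \<Rightarrow> ('a \<Rightarrow> 'b) \<Rightarrow> bool" where
  "equivariant_on G S \<phi> \<psi> f \<longleftrightarrow> (\<forall>g\<in>carrier G. \<forall>x\<in>S. f (\<phi> g x) = \<psi> g (f x))"

definition G_map ::
  "('g, 'x) monoid_scheme \<Rightarrow> 'a topology \<Rightarrow> ('g \<Rightarrow> 'a \<Rightarrow> 'a) \<Rightarrow> 'b topology \<Rightarrow> ('g \<Rightarrow> 'b \<Rightarrow> 'b)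
     \<Rightarrow> ('a \<Rightarrow> 'b) \<Rightarrow> bool" where
  "G_map G X \<phi> Y \<psi> f \<longleftrightarrow> continuous_map X Y f \<and> equivariant_on G (topspace X) \<phi> \<psi> f"

text \<open>A G-homotopy is a homotopy \<open>[0,1] \<times> X \<rightarrow> Y\<close> that is equivariant for the trivial action
  on \<open>[0,1]\<close>, i.e. each of whose stages is equivariant.\<close>

definition G_homotopic ::
  "('g, 'x) monoid_scheme \<Rightarrow> 'a topology \<Rightarrow> ('g \<Rightarrow> 'a \<Rightarrow> 'a) \<Rightarrow> 'b topology \<Rightarrow> ('g \<Rightarrow> 'b \<Rightarrow> 'b)
     \<Rightarrow> ('a \<Rightarrow> 'b) \<Rightarrow> ('a \<Rightarrow> 'b) \<Rightarrow> bool" where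
  "G_homotopic G X \<phi> Y \<psi> = homotopic_with (equivariant_on G (topspace X) \<phi> \<psi>) X Y"

definition invariant_open_cover ::
  "('g, 'x) monoid_scheme \<Rightarrow> 'a topology \<Rightarrow> ('g \<Rightarrow> 'a \<Rightarrow> 'a) \<Rightarrow> nat \<Rightarrow> (nat \<Rightarrow> 'a set) \<Rightarrow> bool" where
  "invariant_open_cover G X \<phi> n U \<longleftrightarrow>
     (\<forall>i\<le>n. openin X (U i) \<and> (\<forall>g\<in>carrier G. \<forall>x\<in>U i. \<phi> g x \<in> U i)) \<and>
     (\<Union>i\<le>n. U i) = topspace X"


section \<open>Equivariant homotopic distance and sectional category\<close>

definition least_or_infinity :: "(nat \<Rightarrow> bool) \<Rightarrow> enat" where
  "least_or_infinity P = (if \<exists>n. P n then enat (LEAST n. P n) else \<infinity>)"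

definition D_G ::
  "('g, 'x) monoid_scheme \<Rightarrow> 'a topology \<Rightarrow> ('g \<Rightarrow> 'a \<Rightarrow> 'a) \<Rightarrow> 'b topology \<Rightarrow> ('g \<Rightarrow> 'b \<Rightarrow> 'b)
     \<Rightarrow> ('a \<Rightarrow> 'b) \<Rightarrow> ('a \<Rightarrow> 'b) \<Rightarrow> enat" where
  "D_G G X \<phi> Y \<psi> f g = least_or_infinity (\<lambda>n. \<exists>U. invariant_open_cover G X \<phi> n U \<and>
     (\<forall>i\<le>n. G_homotopic G (subtopology X (U i)) \<phi> Y \<psi> f g))"

definition secat_G ::
  "('g, 'x) monoid_scheme \<Rightarrow> 'e topology \<Rightarrow> ('g \<Rightarrow> 'e \<Rightarrow> 'e) \<Rightarrow> 'b topology \<Rightarrow> ('g \<Rightarrow> 'b \<Rightarrow> 'b)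
     \<Rightarrow> ('e \<Rightarrow> 'b) \<Rightarrow> enat" where
  "secat_G G E \<epsilon> B \<beta> p = least_or_infinity (\<lambda>n. \<exists>U. invariant_open_cover G B \<beta> n U \<and>
     (\<forall>i\<le>n. \<exists>s. G_map G (subtopology B (U i)) \<beta> E \<epsilon> s \<and>
        G_homotopic G (subtopology B (U i)) \<beta> B \<beta> (p \<circ> s) id))"


section \<open>Path spaces\<close>

text \<open>Paths are made extensional (undefined outside \<open>[0,1]\<close>), so that equality of paths is equality on
  \<open>[0,1]\<close>. For the same reason the actions below are restricted to their carriers, as the
  library's notion of group action demands.\<close>

definition path_set :: "'b topology \<Rightarrow> (real \<Rightarrow> 'b) set" where
  "path_set Y = {\<gamma> \<in> extensional {0..1}. pathin Y \<gamma>}"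

text \<open>The compact-open topology.\<close>

definition path_space :: "'b topology \<Rightarrow> (real \<Rightarrow> 'b) topology" where
  "path_space Y = topology_generated_by
     {{\<gamma> \<in> path_set Y. \<gamma> ` K \<subseteq> V} | K V. compact K \<and> K \<subseteq> {0..1} \<and> openin Y V}"

definition path_action :: "'b topology \<Rightarrow> ('g \<Rightarrow> 'b \<Rightarrow> 'b) \<Rightarrow> 'g \<Rightarrow> (real \<Rightarrow> 'b) \<Rightarrow> (real \<Rightarrow> 'b)" where
  "path_action Y \<psi> g = (\<lambda>\<gamma>\<in>path_set Y. \<lambda>t\<in>{0..1}. \<psi> g (\<gamma> t))"

definition pullback_set ::
  "'a topology \<Rightarrow> 'b topology \<Rightarrow> ('a \<Rightarrow> 'b) \<Rightarrow> ('a \<Rightarrow> 'b) \<Rightarrow> ('a \<times> (real \<Rightarrow> 'b)) set" where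
  "pullback_set X Y f g =
     {(x, \<gamma>). x \<in> topspace X \<and> \<gamma> \<in> path_set Y \<and> f x = \<gamma> 0 \<and> g x = \<gamma> 1}"

definition pullback_space ::
  "'a topology \<Rightarrow> 'b topology \<Rightarrow> ('a \<Rightarrow> 'b) \<Rightarrow> ('a \<Rightarrow> 'b) \<Rightarrow> ('a \<times> (real \<Rightarrow> 'b)) topology" where
  "pullback_space X Y f g = subtopology (prod_topology X (path_space Y)) (pullback_set X Y f g)"

definition pullback_action ::
  "'a topology \<Rightarrow> ('g \<Rightarrow> 'a \<Rightarrow> 'a) \<Rightarrow> 'b topology \<Rightarrow> ('g \<Rightarrow> 'b \<Rightarrow> 'b) \<Rightarrow> ('a \<Rightarrow> 'b) \<Rightarrow> ('a \<Rightarrow> 'b)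
     \<Rightarrow> 'g \<Rightarrow> 'a \<times> (real \<Rightarrow> 'b) \<Rightarrow> 'a \<times> (real \<Rightarrow> 'b)" where
  "pullback_action X \<phi> Y \<psi> f g k =
     (\<lambda>(x, \<gamma>)\<in>pullback_set X Y f g. (\<phi> k x, path_action Y \<psi> k \<gamma>))"

definition pullback_proj :: "'a \<times> (real \<Rightarrow> 'b) \<Rightarrow> 'a" where
  "pullback_proj = (\<lambda>(x, \<gamma>). x)"

end

theory Submission
  imports Defs
begin

text \<open>
  Both invariants count the members of an invariant open cover of \<open>X\<close>, so it suffices to compare
  the conditions imposed on a single invariant open set \<open>U\<close>: the maps \<open>f\<close> and \<open>g\<close> are
  \<open>G\<close>-homotopic on \<open>U\<close> if and only if the projection \<open>p\<close> of the pullback \<open>P\<close> has a section over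
  \<open>U\<close> up to \<open>G\<close>-homotopy.

  A homotopy from \<open>f\<close> to \<open>g\<close> on \<open>U\<close> is, by currying, a continuous choice for each \<open>x\<close> of a path
  from \<open>f x\<close> to \<open>g x\<close>, and hence a strict section of \<open>p\<close>
  (\<open>pullback_section_of_G_homotopic\<close>); currying is continuous for the compact-open topology by
  the tube lemma.

  Conversely, evaluation of paths at time \<open>t\<close> is a \<open>G\<close>-homotopy from \<open>f \<circ> p\<close> to \<open>g \<circ> p\<close>
  on the whole of \<open>P\<close> (\<open>pullback_universal_G_homotopy\<close>); it is jointly continuous because
  \<open>[0,1]\<close> is locally compact. If \<open>s\<close> is a section up to homotopy, composing with \<open>s\<close> and with the
  homotopy \<open>p \<circ> s \<simeq> id\<close> gives \<open>f \<simeq> f \<circ> p \<circ> s \<simeq> g \<circ> p \<circ> s \<simeq> g\<close> on \<open>U\<close>.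
\<close>

section \<open>The compact-open topology on paths\<close>

lemma openin_path_space_subbasic:
  assumes "compact K" "K \<subseteq> {0..1}" "openin Y V"
  shows "openin (path_space Y) {\<gamma> \<in> path_set Y. \<gamma> ` K \<subseteq> V}"
  unfolding path_space_def by (rule topology_generated_by_Basis) (use assms in blast)

lemma topspace_path_space [simp]: "topspace (path_space Y) = path_set Y"
proof -
  \<comment> \<open>the empty compact set imposes no condition, so the whole path set is subbasic open\<close>
  have "openin (path_space Y) (path_set Y)"
    using openin_path_space_subbasic[of "{}" Y "{}"] by simp
  then have "path_set Y \<subseteq> topspace (path_space Y)"
    by (rule openin_subset)
  moreover have "topspace (path_space Y) \<subseteq> path_set Y"
    unfolding path_space_def topology_generated_by_topspace by blast
  ultimately show ?thesis by blast
qed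

lemma curry_in_path_set:
  assumes "continuous_map (prod_topology (top_of_set {0..1}) Z) Y h" "z \<in> topspace Z"
  shows "(\<lambda>t\<in>{0..1}. h (t, z)) \<in> path_set Y"
proof -
  have "continuous_map (top_of_set {0..1}) (prod_topology (top_of_set {0..1}) Z) (\<lambda>t. (t, z))"
    using assms(2) by (simp add: continuous_map_pairwise o_def)
  from continuous_map_compose[OF this assms(1)]
  have "continuous_map (top_of_set {0..1}) Y (\<lambda>t\<in>{0..1}. h (t, z))"
    by (rule continuous_map_eq) simp
  then show ?thesis by (simp add: path_set_def pathin_def)
qed

text \<open>Let \<open>z\<close> be such that \<open>h\<close> carries \<open>K \<times> {z}\<close> into \<open>V\<close>. As \<open>K\<close> is compact, \<open>h\<close> still carries
  \<open>K \<times> N\<close> into \<open>V\<close> for some neighbourhood \<open>N\<close> of \<open>z\<close>; this is what continuity at \<open>z\<close> means for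
  the subbasic open set given by \<open>K\<close> and \<open>V\<close>.\<close>

lemma continuous_map_curry_path_space:
  assumes h: "continuous_map (prod_topology (top_of_set {0..1}) Z) Y h"
  shows "continuous_map Z (path_space Y) (\<lambda>z. \<lambda>t\<in>{0..1}. h (t, z))" (is "continuous_map _ _ ?c")
proof -
  have into: "?c z \<in> path_set Y" if "z \<in> topspace Z" for z
    using curry_in_path_set[OF h that] .
  have op: "openin Z (?c -` {\<gamma> \<in> path_set Y. \<gamma> ` K \<subseteq> V} \<inter> topspace Z)" (is "openin Z ?S")
    if K: "compact K" "K \<subseteq> {0..1}" and V: "openin Y V" for K V
  proof (subst openin_subopen, intro ballI)
    fix z assume z: "z \<in> ?S"
    let ?W = "{w \<in> topspace (prod_topology (top_of_set {0..1}) Z). h w \<in> V}"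
    have W: "openin (prod_topology (top_of_set {0..1}) Z) ?W"
      using h V by (rule openin_continuous_map_preimage)
    have comp: "compactin (top_of_set {0..1}) K"
      using K by (simp add: compactin_subtopology)
    have sub: "K \<times> {z} \<subseteq> ?W"
      using z K(2) by (auto simp: image_subset_iff subset_iff)
    have "z \<in> topspace Z" using z by blast
    from tube_lemma_left[OF W comp this sub]
    obtain M N where MN: "openin Z N" "K \<subseteq> M" "z \<in> N" "M \<times> N \<subseteq> ?W"
      by (elim exE conjE) (rule that)
    have "N \<subseteq> ?S"
    proof
      fix y assume y: "y \<in> N"
      then have "y \<in> topspace Z" using MN(1) openin_subset by blast
      moreover have "h (t, y) \<in> V" if "t \<in> K" for t
        using MN y that by blast
      ultimately show "y \<in> ?S"
        using into K(2) by (auto simp: subset_iff)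
    qed
    with MN show "\<exists>N. openin Z N \<and> z \<in> N \<and> N \<subseteq> ?S" by blast
  qed
  show ?thesis
    unfolding path_space_def
  proof (rule continuous_on_generated_topo)
    show "?c ` topspace Z \<subseteq> \<Union> {{\<gamma> \<in> path_set Y. \<gamma> ` K \<subseteq> V} |K V.
            compact K \<and> K \<subseteq> {0..1} \<and> openin Y V}"
      using into topspace_path_space[of Y]
      unfolding path_space_def topology_generated_by_topspace by blast
  qed (use op in blast)
qed

text \<open>Near a time \<open>t\<close> with \<open>\<gamma> t \<in> V\<close> there is a compact interval \<open>K\<close> around \<open>t\<close> that \<open>\<gamma>\<close> maps into
  \<open>V\<close>; every path in the subbasic neighbourhood given by \<open>K\<close> and \<open>V\<close> is then in \<open>V\<close> at all times
  close to \<open>t\<close>.\<close>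

lemma continuous_map_path_evaluation:
  "continuous_map (prod_topology (top_of_set {0..1}) (path_space Y)) Y (\<lambda>(t, \<gamma>). \<gamma> t)"
  unfolding continuous_map_eq_topcontinuous_at topcontinuous_at_def
proof (intro ballI conjI allI impI; (elim conjE)?)
  let ?D = "prod_topology (top_of_set {0..1}) (path_space Y)"
  have into: "\<gamma> t \<in> topspace Y" if "\<gamma> \<in> path_set Y" "t \<in> {0..1}" for \<gamma> t
    using that by (auto simp: path_set_def pathin_def continuous_map_def)
  show "(\<lambda>(t, \<gamma>). \<gamma> t) \<in> topspace ?D \<rightarrow> topspace Y"
    using into by auto
  fix w V
  assume w: "w \<in> topspace ?D" and V: "openin Y V" "(case w of (t, \<gamma>) \<Rightarrow> \<gamma> t) \<in> V"
  obtain t \<gamma> where w_eq: "w = (t, \<gamma>)" and t: "t \<in> {0..1}" and \<gamma>: "\<gamma> \<in> path_set Y"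
    using w by (cases w) auto
  have "openin (top_of_set {0..1}) {u \<in> topspace (top_of_set {0..1}). \<gamma> u \<in> V}"
    using \<gamma> V by (intro openin_continuous_map_preimage) (auto simp: path_set_def pathin_def)
  then obtain Q where Q: "open Q" "{u \<in> {0..1}. \<gamma> u \<in> V} = {0..1} \<inter> Q"
    by (auto simp: openin_open)
  then have "t \<in> Q" using V t w_eq by auto
  then obtain e where e: "e > 0" "cball t e \<subseteq> Q"
    using Q(1) open_contains_cball by blast
  let ?K = "{0..1} \<inter> cball t e"
  let ?N = "{\<delta> \<in> path_set Y. \<delta> ` ?K \<subseteq> V}"
  have "openin (path_space Y) ?N"
    using V by (intro openin_path_space_subbasic) auto
  then have "openin ?D (({0..1} \<inter> ball t e) \<times> ?N)"
    by (intro openin_prod_Times_iff[THEN iffD2] disjI2 conjI openin_open_Int) auto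
  moreover have "w \<in> ({0..1} \<inter> ball t e) \<times> ?N"
    using w_eq t \<gamma> e Q(2) by auto
  moreover have "\<forall>y\<in>({0..1} \<inter> ball t e) \<times> ?N. (case y of (u, \<delta>) \<Rightarrow> \<delta> u) \<in> V"
    by (auto simp: image_subset_iff)
  ultimately show "\<exists>U. openin ?D U \<and> w \<in> U \<and> (\<forall>y\<in>U. (case y of (u, \<delta>) \<Rightarrow> \<delta> u) \<in> V)"
    by blast
qed


section \<open>Composition of equivariant homotopies\<close>

lemma G_homotopic_compose_left:
  assumes "G_homotopic G S \<sigma> X \<phi> a b" and "G_map G X \<phi> Y \<psi> f"
  shows "G_homotopic G S \<sigma> Y \<psi> (f \<circ> a) (f \<circ> b)"
proof -
  \<comment> \<open>\<open>f\<close> is equivariant on the space \<open>X\<close> only, so the stages must be known to map into it\<close>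
  have "homotopic_with (\<lambda>j. continuous_map S X j \<and> equivariant_on G (topspace S) \<sigma> \<phi> j) S X a b"
    using assms(1) unfolding G_homotopic_def by (rule homotopic_with_mono) auto
  then show ?thesis
    unfolding G_homotopic_def
    by (rule homotopic_with_compose_continuous_map_left)
       (use assms(2) in \<open>auto simp: G_map_def equivariant_on_def continuous_map_def Pi_iff\<close>)
qed

lemma G_homotopic_compose_right:
  assumes "G_homotopic G X \<phi> Y \<psi> a b" and "G_map G S \<sigma> X \<phi> s"
  shows "G_homotopic G S \<sigma> Y \<psi> (a \<circ> s) (b \<circ> s)"
  using assms(1) unfolding G_homotopic_def
  by (rule homotopic_with_compose_continuous_map_right)
     (use assms(2) in \<open>auto simp: G_map_def equivariant_on_def continuous_map_def Pi_iff\<close>)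

lemma G_space_closed:
  assumes "G_space G T X \<phi>" "k \<in> carrier G" "x \<in> topspace X"
  shows "\<phi> k x \<in> topspace X"
  using assms group_action.element_image unfolding G_space_def by metis

lemma G_space_translation_continuous:
  assumes "G_space G T X \<phi>" "k \<in> topspace T"
  shows "continuous_map X X (\<phi> k)"
proof -
  have "continuous_map X (prod_topology T X) (\<lambda>x. (k, x))"
    using assms(2) by (simp add: continuous_map_pairwise o_def)
  moreover have "continuous_map (prod_topology T X) X (\<lambda>(g, x). \<phi> g x)"
    using assms(1) by (simp add: G_space_def)
  ultimately show ?thesis
    using continuous_map_compose by (fastforce simp: o_def)
qed


section \<open>The pullback of the path fibration\<close>

lemma topspace_pullback_space [simp]:
  "topspace (pullback_space X Y f g) = pullback_set X Y f g"
  by (auto simp: pullback_space_def pullback_set_def)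

lemma pullback_action_closed:
  assumes T: "topspace T = carrier G"
    and X: "G_space G T X \<phi>" and Y: "G_space G T Y \<psi>"
    and f: "G_map G X \<phi> Y \<psi> f" and g: "G_map G X \<phi> Y \<psi> g"
    and k: "k \<in> carrier G" and w: "w \<in> pullback_set X Y f g"
  shows "pullback_action X \<phi> Y \<psi> f g k w \<in> pullback_set X Y f g"
proof -
  obtain x \<gamma> where w_eq: "w = (x, \<gamma>)" and x: "x \<in> topspace X" and \<gamma>: "\<gamma> \<in> path_set Y"
    and ends: "f x = \<gamma> 0" "g x = \<gamma> 1"
    using w by (auto simp: pullback_set_def)
  have "pathin Y (\<psi> k \<circ> \<gamma>)"
    using \<gamma> G_space_translation_continuous[OF Y] k T by (auto simp: path_set_def intro: pathin_compose)
  then have "pathin Y (path_action Y \<psi> k \<gamma>)"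
    unfolding pathin_def by (rule continuous_map_eq) (simp add: path_action_def \<gamma>)
  moreover have "path_action Y \<psi> k \<gamma> \<in> extensional {0..1}"
    by (simp add: path_action_def \<gamma>)
  moreover have "f (\<phi> k x) = path_action Y \<psi> k \<gamma> 0" "g (\<phi> k x) = path_action Y \<psi> k \<gamma> 1"
    using f g k x \<gamma> by (auto simp: path_action_def G_map_def equivariant_on_def simp flip: ends)
  ultimately show ?thesis
    using G_space_closed[OF X k x] w
    by (simp add: pullback_action_def w_eq pullback_set_def path_set_def)
qed

text \<open>The second component of a point of the pullback is a path joining the images of its first
  component under \<open>f\<close> and \<open>g\<close>. Following these paths deforms one composite into the other, and each
  stage is equivariant because the group acts on paths pointwise.\<close>

lemma pullback_universal_G_homotopy:
  assumes T: "topspace T = carrier G"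
    and X: "G_space G T X \<phi>" and Y: "G_space G T Y \<psi>"
    and f: "G_map G X \<phi> Y \<psi> f" and g: "G_map G X \<phi> Y \<psi> g"
  shows "G_homotopic G (pullback_space X Y f g) (pullback_action X \<phi> Y \<psi> f g) Y \<psi>
           (f \<circ> pullback_proj) (g \<circ> pullback_proj)"
proof -
  let ?P = "pullback_space X Y f g" and ?\<pi> = "pullback_action X \<phi> Y \<psi> f g"
  let ?I = "top_of_set {0..1::real}"
  have "continuous_map ?P (path_space Y) snd"
    unfolding pullback_space_def
    by (intro continuous_map_from_subtopology continuous_map_snd)
  then have "continuous_map (prod_topology ?I ?P) (path_space Y) (snd \<circ> snd)"
    by (rule continuous_map_compose[OF continuous_map_snd])
  then have "continuous_map (prod_topology ?I ?P) (prod_topology ?I (path_space Y))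
               (\<lambda>(t, w). (t, snd w))"
    using continuous_map_fst[of ?I ?P]
    by (simp add: continuous_map_pairwise o_def case_prod_unfold)
  from continuous_map_compose[OF this continuous_map_path_evaluation]
  have cont: "continuous_map (prod_topology ?I ?P) Y (\<lambda>(t, w). snd w t)"
    by (simp add: o_def case_prod_unfold)
  have equiv: "equivariant_on G (topspace ?P) ?\<pi> \<psi> (\<lambda>w. snd w t)" if "t \<in> {0..1}" for t
    using that
    by (auto simp: equivariant_on_def pullback_action_def path_action_def pullback_set_def)
  \<comment> \<open>evaluation at the ends agrees with the two composites on the pullback only, so equivariance
    must not depend on values elsewhere; this is where invariance of the pullback enters\<close>
  have cong: "equivariant_on G (topspace ?P) ?\<pi> \<psi> h \<longleftrightarrow> equivariant_on G (topspace ?P) ?\<pi> \<psi> k"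
    if "\<And>w. w \<in> topspace ?P \<Longrightarrow> h w = k w" for h k
    using that pullback_action_closed[OF T X Y f g] by (simp add: equivariant_on_def)
  have "homotopic_with (equivariant_on G (topspace ?P) ?\<pi> \<psi>) ?P Y
          (f \<circ> pullback_proj) (g \<circ> pullback_proj)"
  proof (subst homotopic_with[OF cong], assumption, intro exI conjI ballI)
    show "continuous_map (prod_topology ?I ?P) Y (\<lambda>(t, w). snd w t)" by fact
  qed (use equiv in \<open>auto simp: pullback_set_def pullback_proj_def\<close>)
  then show ?thesis by (simp add: G_homotopic_def)
qed

text \<open>The section sends \<open>x\<close> to the track of \<open>x\<close> under the homotopy. Equivariance of the stages says
  that the track of a translate is the translate of the track.\<close>

lemma pullback_section_of_G_homotopic:
  assumes hom: "G_homotopic G (subtopology X U) \<phi> Y \<psi> f g"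
  obtains s where "G_map G (subtopology X U) \<phi> (pullback_space X Y f g)
                     (pullback_action X \<phi> Y \<psi> f g) s"
    and "pullback_proj \<circ> s = id"
proof -
  let ?U = "subtopology X U" and ?P = "pullback_space X Y f g"
  obtain h where h: "continuous_map (prod_topology (top_of_set {0..1::real}) ?U) Y h"
    and ends: "\<And>x. h (0, x) = f x" "\<And>x. h (1, x) = g x"
    and equiv: "\<And>t. t \<in> {0..1} \<Longrightarrow> equivariant_on G (topspace ?U) \<phi> \<psi> (\<lambda>x. h (t, x))"
    using hom unfolding G_homotopic_def homotopic_with_def by blast
  define s where "s = (\<lambda>x. (x, \<lambda>t\<in>{0..1}. h (t, x)))"
  have mem: "s x \<in> pullback_set X Y f g" if "x \<in> topspace ?U" for x
    using that curry_in_path_set[OF h that] by (simp add: s_def pullback_set_def ends)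
  have "continuous_map ?U (prod_topology X (path_space Y)) s"
    using continuous_map_curry_path_space[OF h]
    by (simp add: continuous_map_pairwise s_def o_def continuous_map_from_subtopology)
  then have "continuous_map ?U ?P s"
    using mem by (auto simp: pullback_space_def continuous_map_in_subtopology)
  moreover have "s (\<phi> k x) = pullback_action X \<phi> Y \<psi> f g k (s x)"
    if "k \<in> carrier G" "x \<in> topspace ?U" for k x
  proof -
    have "(\<lambda>t\<in>{0..1}. h (t, \<phi> k x)) = path_action Y \<psi> k (\<lambda>t\<in>{0..1}. h (t, x))"
      using equiv that curry_in_path_set[OF h that(2)]
      by (auto simp: path_action_def equivariant_on_def intro!: restrict_ext)
    then show ?thesis
      using mem[OF that(2)] by (simp add: s_def pullback_action_def)
  qed
  ultimately have "G_map G ?U \<phi> ?P (pullback_action X \<phi> Y \<psi> f g) s"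
    by (simp add: G_map_def equivariant_on_def)
  moreover have "pullback_proj \<circ> s = id"
    by (auto simp: s_def pullback_proj_def)
  ultimately show thesis by (rule that)
qed

lemma G_homotopic_iff_pullback_homotopy_section:
  assumes T: "topspace T = carrier G"
    and X: "G_space G T X \<phi>" and Y: "G_space G T Y \<psi>"
    and f: "G_map G X \<phi> Y \<psi> f" and g: "G_map G X \<phi> Y \<psi> g"
  shows "G_homotopic G (subtopology X U) \<phi> Y \<psi> f g \<longleftrightarrow>
    (\<exists>s. G_map G (subtopology X U) \<phi> (pullback_space X Y f g) (pullback_action X \<phi> Y \<psi> f g) s \<and>
         G_homotopic G (subtopology X U) \<phi> X \<phi> (pullback_proj \<circ> s) id)"
    (is "?hom \<longleftrightarrow> (\<exists>s. ?section s)")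
proof
  assume ?hom
  then obtain s where "G_map G (subtopology X U) \<phi> (pullback_space X Y f g)
      (pullback_action X \<phi> Y \<psi> f g) s" and "pullback_proj \<circ> s = id"
    by (rule pullback_section_of_G_homotopic)
  moreover have "G_homotopic G (subtopology X U) \<phi> X \<phi> id id"
    by (simp add: G_homotopic_def equivariant_on_def continuous_map_from_subtopology)
  ultimately show "\<exists>s. ?section s" by metis
next
  assume "\<exists>s. ?section s"
  then obtain s where s: "G_map G (subtopology X U) \<phi> (pullback_space X Y f g)
      (pullback_action X \<phi> Y \<psi> f g) s"
    and id: "G_homotopic G (subtopology X U) \<phi> X \<phi> (pullback_proj \<circ> s) id"
    by blast
  have "G_homotopic G (subtopology X U) \<phi> Y \<psi> (f \<circ> (pullback_proj \<circ> s)) f"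
    "G_homotopic G (subtopology X U) \<phi> Y \<psi> (g \<circ> (pullback_proj \<circ> s)) g"
    using G_homotopic_compose_left[OF id f] G_homotopic_compose_left[OF id g] by simp_all
  moreover have "G_homotopic G (subtopology X U) \<phi> Y \<psi>
      (f \<circ> (pullback_proj \<circ> s)) (g \<circ> (pullback_proj \<circ> s))"
    using G_homotopic_compose_right[OF pullback_universal_G_homotopy[OF T X Y f g] s]
    by (simp add: o_assoc)
  ultimately show ?hom
    unfolding G_homotopic_def by (meson homotopic_with_symD homotopic_with_trans)
qed

theorem theorem3p3:
  fixes G :: "('g, 'x) monoid_scheme" and T :: "'g topology" and n :: nat and A :: "'g chart set"
    and X :: "'a topology" and \<phi> :: "'g \<Rightarrow> 'a \<Rightarrow> 'a"
    and Y :: "'b topology" and \<psi> :: "'g \<Rightarrow> 'b \<Rightarrow> 'b"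
    and f g :: "'a \<Rightarrow> 'b"
  assumes "compact_Lie_group G T n A"
    and "G_space G T X \<phi>" and "G_space G T Y \<psi>"
    and "G_map G X \<phi> Y \<psi> f" and "G_map G X \<phi> Y \<psi> g"
  shows "D_G G X \<phi> Y \<psi> f g =
    secat_G G (pullback_space X Y f g) (pullback_action X \<phi> Y \<psi> f g) X \<phi> pullback_proj"
proof -
  have "topspace T = carrier G"
    using assms(1) by (simp add: compact_Lie_group_def)
  from G_homotopic_iff_pullback_homotopy_section[OF this assms(2-5)]
  show ?thesis by (simp add: D_G_def secat_G_def)
qed

end
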